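(* Let $F^{\mathbf a}=(F^{\mathbf a}_k)_{k=-n+1}^\infty$ be a solution of a linear recurrence $F$ of order $n$ with complex signature $(b_1,\dots,b_n)$, $b_n\neq0$. The ratio limit $$\lim_{k_0<k\to\infty}\frac{F^{\mathbf a}_{k+1}}{F^{\mathbf a}_k},\quad\text{where } F^{\mathbf a}_k\neq0 \text{ for } k>k_0,$$ exists if and only if the characteristic polynomial $P^{\mathbf a}$ of the solution $F^{\mathbf a}$ is asymptotically simple. If this holds, then $$\lim_{k_0<k\to\infty}\frac{F^{\mathbf a}_{k+1}}{F^{\mathbf a}_k}=\lambda_{i_0},$$ where $\lambda_{i_0}$ is the dominant zero of $P^{\mathbf a}$.
   Context: A linear recurrence $F$ of order $n$ with signature $(b_1,\dots,b_n)\in\mathbb C^n$, $b_n\neq0$, generates from initial conditions $\mathbf a=(a_{-n+1},\dots,a_0)\in\mathbb C^n$ the sequence (solution) $F^{\mathbf a}$ with $F^{\mathbf a}_k=a_k$ for $-n+1\le k\le 0$ and $F^{\mathbf a}_k=b_1F^{\mathbf a}_{k-1}+\cdots+b_nF^{\mathbf a}_{k-n}$ for $k>0$. Its characteristic polynomial is $P=\lambda^n-b_1\lambda^{n-1}-\cdots-b_n$, with distinct zeros $\lambda_1,\dots,\lambda_\nu$ of multiplicities $\mu_1,\dots,\mu_\nu$ ($\sum\mu_i=n$). Every solution can be written uniquely as $F^{\mathbf a}_k=\sum_{i=1}^{\nu}\sum_{j=0}^{\mu_i-1}c^{\mathbf a}_{ij}k^j\lambda_i^k$ for $k\ge -n+1$.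 The characteristic polynomial $P^{\mathbf a}$ of the solution $F^{\mathbf a}$ is defined as follows: its zeros are those $\lambda_i$ for which some $c^{\mathbf a}_{ij}\neq0$, and the multiplicity of $\lambda_i$ in $P^{\mathbf a}$ is the largest index $j$ with $c^{\mathbf a}_{ij}\neq0$. A polynomial is called asymptotically simple iff among its zeros of maximal modulus there is a (unique) dominant zero of maximal multiplicity. *)

theory Defs
  imports Complex_Main "HOL-Computational_Algebra.Polynomial"
begin

text \<open>
  A recurrence of order \<open>n\<close> is given by its signature \<open>b 1, \<dots>, b n\<close>, initial conditions by
  \<open>a (1 - n), \<dots>, a 0\<close>. Only these values of \<open>b\<close> and \<open>a\<close> are significant; the sequence is
  significant at indices \<open>k \<ge> 1 - n\<close>, and no value below \<open>1 - n\<close> is used by the recursion.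
\<close>

function rec_solution :: "nat \<Rightarrow> (nat \<Rightarrow> complex) \<Rightarrow> (int \<Rightarrow> complex) \<Rightarrow> int \<Rightarrow> complex" where
  "rec_solution n b a k =
     (if k \<le> 0 then a k else (\<Sum>i = 1..n. b i * rec_solution n b a (k - int i)))"
  by pat_completeness auto
termination
  by (relation "Wellfounded.measure (\<lambda>(n, b, a, k). nat k)") auto

declare rec_solution.simps [simp del]

definition char_poly_rec :: "nat \<Rightarrow> (nat \<Rightarrow> complex) \<Rightarrow> complex poly" where
  "char_poly_rec n b = monom 1 n - (\<Sum>i = 1..n. monom (b i) (n - i))"

text \<open>
  The coefficients are indexed by the zero \<open>z\<close> itself instead of a numbering of the zeros, and
  are extended by \<open>0\<close> outside the range of the double sum, so that they are uniquely determined
  when \<open>n \<ge> 1\<close> and \<open>b n \<noteq> 0\<close>.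
\<close>

definition represents_solution ::
  "nat \<Rightarrow> (nat \<Rightarrow> complex) \<Rightarrow> (int \<Rightarrow> complex) \<Rightarrow> (complex \<Rightarrow> nat \<Rightarrow> complex) \<Rightarrow> bool" where
  "represents_solution n b a c \<longleftrightarrow>
     (\<forall>z j. \<not> (poly (char_poly_rec n b) z = 0 \<and> j < order z (char_poly_rec n b)) \<longrightarrow> c z j = 0) \<and>
     (\<forall>k \<ge> 1 - int n. rec_solution n b a k =
        (\<Sum>z | poly (char_poly_rec n b) z = 0.
           \<Sum>j < order z (char_poly_rec n b). c z j * of_int k ^ j * z powi k))"

definition solution_coeff ::
  "nat \<Rightarrow> (nat \<Rightarrow> complex) \<Rightarrow> (int \<Rightarrow> complex) \<Rightarrow> complex \<Rightarrow> nat \<Rightarrow> complex" where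
  "solution_coeff n b a = (THE c. represents_solution n b a c)"

text \<open>
  Since the powers \<open>k ^ j\<close> are counted from \<open>j = 0\<close>, a zero whose largest index with nonzero
  coefficient is \<open>j\<close> has multiplicity \<open>j + 1\<close>. For the zero solution the product is empty and
  the polynomial is \<open>1\<close>.
\<close>

definition char_poly_solution ::
  "nat \<Rightarrow> (nat \<Rightarrow> complex) \<Rightarrow> (int \<Rightarrow> complex) \<Rightarrow> complex poly" where
  "char_poly_solution n b a =
     (\<Prod>z | \<exists>j. solution_coeff n b a z j \<noteq> 0.
        [:- z, 1:] ^ (Max {j. solution_coeff n b a z j \<noteq> 0} + 1))"

definition max_modulus_zeros :: "complex poly \<Rightarrow> complex set" where
  "max_modulus_zeros p =
     {z. poly p z = 0 \<and> (\<forall>w. poly p w = 0 \<longrightarrow> cmod w \<le> cmod z)}"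

definition is_dominant_zero :: "complex poly \<Rightarrow> complex \<Rightarrow> bool" where
  "is_dominant_zero p z \<longleftrightarrow>
     z \<in> max_modulus_zeros p \<and> (\<forall>w \<in> max_modulus_zeros p. order w p \<le> order z p)"

definition asymptotically_simple :: "complex poly \<Rightarrow> bool" where
  "asymptotically_simple p \<longleftrightarrow> (\<exists>!z. is_dominant_zero p z)"

definition dominant_zero :: "complex poly \<Rightarrow> complex" where
  "dominant_zero p = (THE z. is_dominant_zero p z)"

text \<open>
  The ratios must be defined from some index on; division by zero in HOL would otherwise give
  spurious limits, for instance for the zero sequence.
\<close>

definition has_ratio_limit :: "(int \<Rightarrow> complex) \<Rightarrow> complex \<Rightarrow> bool" where
  "has_ratio_limit F L \<longleftrightarrow>
     (\<exists>k0. \<forall>k > k0. F k \<noteq> 0) \<and> ((\<lambda>k. F (k + 1) / F k) \<longlongrightarrow> L) at_top"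

end

theory Submission imports Defs "HOL-Computational_Algebra.Fundamental_Theorem_Algebra"
begin

text \<open>
  The solution is an exponential polynomial, the sum of \<open>C z k * z ^ k\<close> over finitely many
  \<open>z\<close> with polynomials \<open>C z\<close>. Let \<open>r\<close> be the maximal modulus of such a \<open>z\<close> and \<open>m\<close>
  the maximal degree of \<open>C z\<close> among those of modulus \<open>r\<close>. Divided by \<open>k ^ m * r ^ k\<close>, the
  solution differs by a null sequence from \<open>u k\<close>, the sum of \<open>c z * (z / r) ^ k\<close> over the
  \<open>z\<close> of modulus \<open>r\<close>, where \<open>c z\<close> is the coefficient of \<open>C z\<close> at \<open>m\<close>. If exactly one
  \<open>c z\<close> is nonzero, the ratios tend to this \<open>z\<close>. Conversely, a ratio limit \<open>L\<close> makes
  \<open>r * u (k + 1) - L * u k\<close> a null sequence; its coefficients are \<open>c z * (z - L)\<close>, and a sum of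
  this form tends to \<open>0\<close> only if all coefficients vanish, since a polynomial in the shift operator
  isolates any single one of them. The same fact gives uniqueness of the representation.
\<close>

section \<open>Exponential polynomials and polynomials in the shift operator\<close>

definition exp_poly :: "(complex \<Rightarrow> complex poly) \<Rightarrow> int \<Rightarrow> complex" where
  "exp_poly C k = (\<Sum>z | C z \<noteq> 0. poly (C z) (of_int k) * z powi k)"

text \<open>A common finite index set allows termwise comparison of exponential polynomials whose
  supports differ.\<close>

lemma exp_poly_eq_sum:
  assumes "finite S" "{z. C z \<noteq> 0} \<subseteq> S"
  shows "exp_poly C k = (\<Sum>z\<in>S. poly (C z) (of_int k) * z powi k)"
  unfolding exp_poly_def by (rule sum.mono_neutral_left) (use assms in auto)

text \<open>This is p(E) applied to \<open>f\<close>, where E is the shift operator sending f(k) to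
  f(k + 1).\<close>

definition shift_op :: "complex poly \<Rightarrow> (int \<Rightarrow> complex) \<Rightarrow> int \<Rightarrow> complex" where
  "shift_op p f k = (\<Sum>i\<le>degree p. coeff p i * f (k + int i))"

lemma shift_op_eq_sum:
  assumes "degree p \<le> N"
  shows "shift_op p f k = (\<Sum>i\<le>N. coeff p i * f (k + int i))"
  unfolding shift_op_def
  by (rule sum.mono_neutral_left) (use assms in \<open>auto simp: coeff_eq_0\<close>)

lemma shift_op_pCons: "shift_op (pCons c p) f k = c * f k + shift_op p f (k + 1)"
proof -
  have "shift_op (pCons c p) f k = (\<Sum>i\<le>Suc (degree p). coeff (pCons c p) i * f (k + int i))"
    by (rule shift_op_eq_sum) (rule degree_pCons_le)
  also have "\<dots> = c * f k + (\<Sum>i\<le>degree p. coeff p i * f (k + 1 + int i))"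
    by (subst sum.atMost_Suc_shift) (simp add: algebra_simps)
  finally show ?thesis by (simp add: shift_op_def)
qed

lemma shift_op_0: "shift_op 0 f k = 0"
  by (simp add: shift_op_def)

text \<open>Substituting E is multiplicative: (E - z) can be applied first and q(E) afterwards. This
  permits induction on the degree by splitting off one zero at a time.\<close>

lemma shift_op_linear_factor:
  "shift_op ([:-z, 1:] * q) f k = shift_op q (\<lambda>k. f (k + 1) - z * f k) k"
proof (induction q arbitrary: k)
  case (pCons c q)
  have "shift_op ([:-z, 1:] * pCons c q) f k = shift_op (pCons (-z * c) ([:-z, 1:] * q + [:c:])) f k"
    by (rule arg_cong[where f = "\<lambda>p. shift_op p f k"]) (simp add: algebra_simps)
  also have "\<dots> = - z * c * f k + (shift_op ([:-z, 1:] * q) f (k + 1) + c * f (k + 1))"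
  proof -
    have "shift_op (p + [:c:]) f j = shift_op p f j + c * f j" for p j
      by (cases p) (simp add: shift_op_pCons algebra_simps)
    thus ?thesis by (simp add: shift_op_pCons del: mult_pCons_left)
  qed
  also have "\<dots> = shift_op (pCons c q) (\<lambda>k. f (k + 1) - z * f k) k"
    unfolding pCons.IH by (simp add: shift_op_pCons algebra_simps)
  finally show ?case .
qed (simp add: shift_op_0)

section \<open>The kernel of a polynomial in the shift operator\<close>

lemma pcompose_monom_shift: "pcompose (monom (c::complex) d) [:1, 1:] = smult c ([:1, 1:] ^ d)"
  by (induction d) (auto simp: monom_0 monom_Suc pcompose_pCons)

lemma coeff_pcompose_monom_shift:
  "coeff (pcompose (monom (c::complex) d) [:1, 1:]) i = c * of_nat (d choose i)"
proof (cases "i \<le> d")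
  case False
  hence "degree ([:1, 1::complex:] ^ d) < i"
    using degree_power_le[of "[:1, 1::complex:]" d] by simp
  thus ?thesis using False by (simp add: pcompose_monom_shift coeff_eq_0)
qed (simp add: pcompose_monom_shift coeff_linear_poly_power)

text \<open>Applied to B(k) * w^k, the operator E - z gives (w * B(k + 1) - z * B(k)) * w^k, so the
  claim is that polynomial right-hand sides can be reached. If w differs from z, the operator on B
  multiplies the top coefficient by w - z and keeps the degree. If w = z (resonance), it lowers the
  degree by one, so B needs one more coefficient. The equation is solved from the top coefficient
  downwards.\<close>

lemma ex_poly_difference:
  fixes w z :: complex
  assumes "w \<noteq> 0" "\<forall>i\<ge>d. coeff A i = 0"
  shows "\<exists>B. smult w (pcompose B [:1, 1:]) - smult z B = A \<and>
             (\<forall>i\<ge>d + (if w = z then 1 else 0). coeff B i = 0)"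
  using assms(2)
proof (induction d arbitrary: A)
  case 0
  hence "A = 0" by (simp add: poly_eq_iff)
  thus ?case by (intro exI[of _ 0]) auto
next
  case (Suc d)
  define D where "D B = smult w (pcompose B [:1, 1:]) - smult z B" for B
  define e where "e = (if w = z then 1 else 0 :: nat)"
  \<comment> \<open>The divisor is the coefficient at \<open>d\<close> in the image of the monic
    monomial of degree \<open>d + e\<close>: either w - z, or, by the binomial theorem, w * (d +
    1).\<close>
  define c where "c = coeff A d / (if w = z then w * of_nat (d + 1) else w - z)"
  define M where "M = monom c (d + e)"
  have coeff_D_M: "coeff (D M) i = coeff A i" if "i \<ge> d" for i
  proof -
    have w: "w * (1 + of_nat d) \<noteq> 0"
      using assms(1) of_nat_neq_0[of d, where ?'a = complex] by (simp add: add.commute)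
    from that have "i = d \<or> i = Suc d \<or> i > Suc d" by arith
    then consider "i = d" | "i = Suc d" | "i > Suc d" by blast
    thus ?thesis
    proof cases
      case 1
      thus ?thesis using w
        by (auto simp: D_def M_def coeff_pcompose_monom_shift e_def c_def diff_divide_distrib field_simps)
    qed (use Suc.prems in \<open>auto simp: D_def M_def coeff_pcompose_monom_shift e_def\<close>)
  qed
  have "\<forall>i\<ge>d. coeff (A - D M) i = 0" using coeff_D_M by simp
  from Suc.IH[OF this] obtain B where B: "D B = A - D M" "\<forall>i\<ge>d + e. coeff B i = 0"
    unfolding D_def e_def by blast
  have "D (B + M) = D B + D M"
    by (simp add: D_def pcompose_add smult_add_right)
  hence "D (B + M) = A" using B(1) by simp
  moreover have "\<forall>i\<ge>Suc d + e. coeff (B + M) i = 0" using B(2) by (auto simp: M_def)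
  ultimately show ?case unfolding D_def e_def by blast
qed

lemma geometric_if_shift_eq:
  fixes f :: "int \<Rightarrow> complex"
  assumes "z \<noteq> 0" "\<And>k. k \<ge> k0 \<Longrightarrow> f (k + 1) = z * f k" "k \<ge> k0"
  shows "f k = f k0 * z powi (- k0) * z powi k"
  using assms(3)
proof (induction k rule: int_ge_induct)
  case base
  thus ?case using assms(1) by (simp add: power_int_minus)
next
  case (step k)
  thus ?case using assms by (simp add: power_int_add_1)
qed

text \<open>Induction on the degree: for p = (x - z) * q, the sequence f(k + 1) - z * f(k) is
  annihilated by q(E), hence an exponential polynomial. Solving this first-order equation yields f
  up to a multiple of z^k. The condition at 0 keeps all zeros nonzero, so negative exponents cause
  no harm.\<close>

lemma shift_op_0_imp_exp_poly:
  assumes "poly p 0 \<noteq> 0" "\<And>k. k \<ge> k0 \<Longrightarrow> shift_op p f k = 0"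
  shows "\<exists>C. (\<forall>z. \<forall>i\<ge>order z p. coeff (C z) i = 0) \<and> (\<forall>k\<ge>k0. f k = exp_poly C k)"
  using assms
proof (induction "degree p" arbitrary: p f)
  case 0
  then obtain c where p: "p = [:c:]" by (metis degree_eq_zeroE)
  with "0.prems" have "\<forall>k\<ge>k0. f k = 0" by (auto simp: shift_op_def)
  thus ?case using p "0.prems" by (intro exI[of _ "\<lambda>_. 0"]) (auto simp: exp_poly_def)
next
  case (Suc N)
  from Suc.hyps(2) have "\<not> constant (poly p)" by (simp add: constant_degree)
  then obtain z where "poly p z = 0" using fundamental_theorem_of_algebra by blast
  then obtain q where p: "p = [:-z, 1:] * q" by (auto simp: poly_eq_0_iff_dvd)
  have "p \<noteq> 0" using Suc.prems(1) by auto
  hence "q \<noteq> 0" using p by auto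
  have "z \<noteq> 0" "poly q 0 \<noteq> 0" using Suc.prems(1) by (auto simp: p)
  have "degree p = Suc (degree q)" unfolding p using \<open>q \<noteq> 0\<close> by (subst degree_mult_eq) auto
  hence "N = degree q" using Suc.hyps(2) by simp
  define g where "g k = f (k + 1) - z * f k" for k
  have "shift_op q g k = 0" if "k \<ge> k0" for k
    using Suc.prems(2)[OF that] unfolding p shift_op_linear_factor g_def .
  with Suc.hyps(1)[OF \<open>N = degree q\<close> \<open>poly q 0 \<noteq> 0\<close>, of g] obtain C where
    C: "\<And>w i. i \<ge> order w q \<Longrightarrow> coeff (C w) i = 0" "\<And>k. k \<ge> k0 \<Longrightarrow> g k = exp_poly C k"
    by blast
  \<comment> \<open>The multiplicity grows by one exactly at z, which is the extra coefficient
    needed in the case of resonance.\<close>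
  have order_p: "order w p = order w q + (if w = z then 1 else 0)" for w
    using \<open>p \<noteq> 0\<close> order_power_n_n[of z 1] unfolding p
    by (subst order_mult) (auto simp: order_0I)
  have "\<exists>B. smult w (pcompose B [:1, 1:]) - smult z B = C w \<and> (\<forall>i\<ge>order w p. coeff B i = 0)"
    if "w \<noteq> 0" for w
    unfolding order_p using ex_poly_difference[OF that] C(1) by blast
  then obtain B where
    B: "\<And>w. w \<noteq> 0 \<Longrightarrow> smult w (pcompose (B w) [:1, 1:]) - smult z (B w) = C w"
       "\<And>w i. w \<noteq> 0 \<Longrightarrow> i \<ge> order w p \<Longrightarrow> coeff (B w) i = 0"
    by metis
  define R where "R = {w. poly p w = 0}"
  have "finite R" unfolding R_def by (rule poly_roots_finite[OF \<open>p \<noteq> 0\<close>])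
  have "z \<in> R" using p by (simp add: R_def)
  have "0 \<notin> R" using Suc.prems(1) by (simp add: R_def)
  have not_R: "order w p = 0" if "w \<notin> R" for w using that by (simp add: R_def order_0I)
  have "{w. C w \<noteq> 0} \<subseteq> R"
  proof -
    have "C w = 0" if "w \<notin> R" for w
      using C(1)[of w] not_R[OF that] by (simp add: order_p poly_eq_iff)
    thus ?thesis by blast
  qed
  \<comment> \<open>A particular solution of the inhomogeneous equation h(k + 1) - z * h(k) =
    g(k).\<close>
  define h where "h k = (\<Sum>w\<in>R. poly (B w) (of_int k) * w powi k)" for k
  have h: "h (k + 1) - z * h k = exp_poly C k" for k
  proof -
    have "h (k + 1) - z * h k =
          (\<Sum>w\<in>R. poly (smult w (pcompose (B w) [:1, 1:]) - smult z (B w)) (of_int k) * w powi k)"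
      unfolding h_def sum_distrib_left sum_subtractf[symmetric]
    proof (rule sum.cong[OF refl])
      fix w assume "w \<in> R"
      hence "w \<noteq> 0" using \<open>0 \<notin> R\<close> by auto
      thus "poly (B w) (of_int (k + 1)) * w powi (k + 1) - z * (poly (B w) (of_int k) * w powi k)
          = poly (smult w (pcompose (B w) [:1, 1:]) - smult z (B w)) (of_int k) * w powi k"
        by (simp add: poly_pcompose power_int_add algebra_simps)
    qed
    also have "\<dots> = (\<Sum>w\<in>R. poly (C w) (of_int k) * w powi k)"
      by (rule sum.cong[OF refl], subst B(1)) (use \<open>0 \<notin> R\<close> in auto)
    finally show ?thesis using exp_poly_eq_sum[OF \<open>finite R\<close> \<open>{w. C w \<noteq> 0} \<subseteq> R\<close>] by simp
  qed
  \<comment> \<open>The homogeneous part f - h is geometric with ratio z; its factor is fixed by the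
    value at \<open>k0\<close>.\<close>
  define e where "e = (f k0 - h k0) * z powi (- k0)"
  have f: "f k = h k + e * z powi k" if "k \<ge> k0" for k
  proof -
    have "f (k + 1) - h (k + 1) = z * (f k - h k)" if "k \<ge> k0" for k
      using C(2)[OF that] h[of k] by (simp add: g_def algebra_simps)
    from geometric_if_shift_eq[where f = "\<lambda>k. f k - h k", OF \<open>z \<noteq> 0\<close> this that]
    show ?thesis by (simp add: e_def algebra_simps)
  qed
  \<comment> \<open>Nothing is known about \<open>B 0\<close>, hence the restriction to
    \<open>R\<close>. The constant \<open>e\<close> is admissible at z because z has positive order
    in p.\<close>
  define E where "E w = (if w \<in> R then B w + (if w = z then [:e:] else 0) else 0)" for w
  have "f k = exp_poly E k" if "k \<ge> k0" for k
  proof -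
    have "exp_poly E k = (\<Sum>w\<in>R. poly (E w) (of_int k) * w powi k)"
      by (rule exp_poly_eq_sum[OF \<open>finite R\<close>]) (auto simp: E_def)
    also have "\<dots> = (\<Sum>w\<in>R. poly (B w) (of_int k) * w powi k + (if w = z then e * z powi k else 0))"
      by (rule sum.cong) (auto simp: E_def algebra_simps)
    also have "\<dots> = h k + e * z powi k"
      using \<open>finite R\<close> \<open>z \<in> R\<close> by (simp add: sum.distrib h_def)
    finally show ?thesis using f[OF that] by simp
  qed
  moreover have "coeff (E w) i = 0" if "i \<ge> order w p" for w i
  proof (cases "w \<in> R")
    case True
    hence "w \<noteq> 0" using \<open>0 \<notin> R\<close> by auto
    have "i \<noteq> 0" if "w = z" using that \<open>i \<ge> order w p\<close> by (auto simp: order_p)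
    thus ?thesis using B(2)[OF \<open>w \<noteq> 0\<close> \<open>i \<ge> order w p\<close>]
      by (auto simp: E_def coeff_pCons split: nat.splits)
  qed (simp add: E_def)
  ultimately show ?case by blast
qed

section \<open>Limits of normalised polynomials, powers and power sums\<close>

lemma of_nat_power_times_power_tendsto_0:
  fixes x :: complex
  assumes "norm x < 1"
  shows "(\<lambda>n. of_nat n ^ j * x ^ n) \<longlonglongrightarrow> 0"
  using assms
proof (induction j arbitrary: x)
  case 0
  thus ?case by (simp add: LIMSEQ_power_zero)
next
  case (Suc j)
  \<comment> \<open>With a square root s of x, the next term splits as (n * s^n) * (n^j * s^n), and
    s still has modulus below 1.\<close>
  define s where "s = csqrt x"
  have x: "x = s * s" using power2_csqrt[of x] by (simp add: s_def power2_eq_square)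
  have "norm s < 1" 
  proof (rule ccontr)
    assume "\<not> norm s < 1"
    hence "1 * 1 \<le> norm s * norm s" by (intro mult_mono) auto
    thus False using Suc.prems by (simp add: x norm_mult)
  qed
  from tendsto_mult[OF powser_times_n_limit_0[OF this] Suc.IH[OF this]]
  show ?case by (simp add: x power_mult_distrib mult_ac)
qed

text \<open>Since \<open>m\<close> may exceed the degree, this covers both the terms that contribute
  to the limit and those that vanish in it.\<close>

lemma poly_over_power_tendsto:
  assumes "degree p \<le> m"
  shows "(\<lambda>k. poly p (of_nat k) / of_nat k ^ m :: complex) \<longlonglongrightarrow> coeff p m"
  using assms
proof (induction p arbitrary: m)
  case (pCons a p)
  show ?case
  proof (cases m)
    case 0
    hence "p = 0" using pCons.prems by (auto split: if_splits)
    thus ?thesis using 0 by simp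
  next
    case (Suc m')
    have inv: "(\<lambda>k. 1 / of_nat k :: complex) \<longlonglongrightarrow> 0" by (rule lim_1_over_n)
    have "(\<lambda>k. (1 / of_nat k :: complex) ^ m) \<longlonglongrightarrow> 0 ^ m" by (rule tendsto_power[OF inv])
    hence "(\<lambda>k. a * (1 / of_nat k) ^ m) \<longlonglongrightarrow> a * 0" using Suc by (intro tendsto_mult tendsto_const) simp
    moreover have "(\<lambda>k. poly p (of_nat k) / of_nat k ^ m') \<longlonglongrightarrow> coeff p m'"
      using pCons.prems Suc by (intro pCons.IH) (auto split: if_splits)
    ultimately have "(\<lambda>k. a * (1 / of_nat k) ^ m + poly p (of_nat k) / of_nat k ^ m')
        \<longlonglongrightarrow> a * 0 + coeff p m'" by (rule tendsto_add)
    hence lim: "(\<lambda>k. a * (1 / of_nat k) ^ m + poly p (of_nat k) / of_nat k ^ m') \<longlonglongrightarrow> coeff (pCons a p) m"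
      by (simp add: Suc)
    show ?thesis
    proof (rule Lim_transform_eventually[OF lim])
      show "\<forall>\<^sub>F k in sequentially. a * (1 / of_nat k) ^ m + poly p (of_nat k) / of_nat k ^ m'
          = poly (pCons a p) (of_nat k) / of_nat k ^ m"
        using eventually_gt_at_top[of 0]
        by eventually_elim (simp add: Suc field_simps)
    qed
  qed
qed simp

text \<open>Multiplying each coefficient c(w) by w amounts to shifting the index, so the null limit
  survives multiplication by q(w) for every polynomial q. A suitable q leaves a single term, whose
  normalised modulus is constant.\<close>

lemma power_sum_tendsto_0_imp_coeff_0:
  fixes c :: "complex \<Rightarrow> complex"
  assumes "finite T" "r > 0" "\<And>w. w \<in> T \<Longrightarrow> cmod w = r"
    and lim: "(\<lambda>k. (\<Sum>w\<in>T. c w * w ^ k) / of_real r ^ k) \<longlonglongrightarrow> 0"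
    and "z \<in> T"
  shows "c z = 0"
proof -
  have poly_lim: "(\<lambda>k. (\<Sum>w\<in>T. c w * poly q w * w ^ k) / of_real r ^ k) \<longlonglongrightarrow> 0" for q
  proof (induction q)
    case (pCons a q)
    have "(\<lambda>k. a * ((\<Sum>w\<in>T. c w * w ^ k) / of_real r ^ k)
        + of_real r * ((\<Sum>w\<in>T. c w * poly q w * w ^ Suc k) / of_real r ^ Suc k)) \<longlonglongrightarrow> a * 0 + of_real r * 0"
      by (intro tendsto_add tendsto_mult tendsto_const lim LIMSEQ_Suc[OF pCons.IH])
    moreover have "a * ((\<Sum>w\<in>T. c w * w ^ k) / of_real r ^ k)
        + of_real r * ((\<Sum>w\<in>T. c w * poly q w * w ^ Suc k) / of_real r ^ Suc k)
        = (\<Sum>w\<in>T. c w * poly (pCons a q) w * w ^ k) / of_real r ^ k" for k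
    proof -
      have "(\<Sum>w\<in>T. c w * poly (pCons a q) w * w ^ k)
          = a * (\<Sum>w\<in>T. c w * w ^ k) + (\<Sum>w\<in>T. c w * poly q w * w ^ Suc k)"
        by (simp add: sum_distrib_left algebra_simps flip: sum.distrib)
      thus ?thesis using \<open>r > 0\<close> by (simp add: add_divide_distrib)
    qed
    ultimately show ?case by simp
  qed simp
  \<comment> \<open>As in Lagrange interpolation, q vanishes on \<open>T\<close> except at
    z.\<close>
  define q where "q = (\<Prod>w\<in>T - {z}. [:-w, 1:])"
  have "poly q w = 0" if "w \<in> T - {z}" for w
    using that \<open>finite T\<close> by (auto simp: q_def poly_prod)
  hence "(\<Sum>w\<in>T. c w * poly q w * w ^ k) = c z * poly q z * z ^ k" for k
    using \<open>finite T\<close> \<open>z \<in> T\<close> by (simp add: sum.remove)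
  with poly_lim[of q] have "(\<lambda>k. c z * poly q z * z ^ k / of_real r ^ k) \<longlonglongrightarrow> 0" by simp
  hence "(\<lambda>k. cmod (c z * poly q z * z ^ k / of_real r ^ k)) \<longlonglongrightarrow> 0" by (rule tendsto_norm_zero)
  hence "(\<lambda>k::nat. cmod (c z * poly q z)) \<longlonglongrightarrow> 0"
    using assms(3)[OF \<open>z \<in> T\<close>] \<open>r > 0\<close> by (simp add: norm_mult norm_divide norm_power)
  hence "c z * poly q z = 0" by (simp add: LIMSEQ_const_iff)
  moreover have "poly q z \<noteq> 0" using \<open>finite T\<close> by (auto simp: q_def poly_prod)
  ultimately show ?thesis by simp
qed


text \<open>Each summand is treated separately: on the circle of radius r the polynomial factor
  tends to its coefficient at \<open>m\<close>, inside the circle exponential decay wins.\<close>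

lemma exp_poly_asymptotics:
  assumes "finite {z. C z \<noteq> 0}" "r > 0"
    and "\<And>z. C z \<noteq> 0 \<Longrightarrow> cmod z \<le> r"
    and "\<And>z. C z \<noteq> 0 \<Longrightarrow> cmod z = r \<Longrightarrow> degree (C z) \<le> m"
  shows "(\<lambda>k. exp_poly C (int k) / (of_nat k ^ m * of_real r ^ k)
            - (\<Sum>z | C z \<noteq> 0 \<and> cmod z = r. coeff (C z) m * z ^ k) / of_real r ^ k) \<longlonglongrightarrow> 0"
proof -
  define t where "t z k = poly (C z) (of_nat k) * z ^ k / (of_nat k ^ m * of_real r ^ k)
      - (if cmod z = r then coeff (C z) m * z ^ k / of_real r ^ k else 0)" for z and k :: nat
  have "t z \<longlonglongrightarrow> 0" if "C z \<noteq> 0" for z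
  proof (cases "cmod z = r")
    case True
    have "(\<lambda>k. poly (C z) (of_nat k) / of_nat k ^ m - coeff (C z) m) \<longlonglongrightarrow> coeff (C z) m - coeff (C z) m"
      by (intro tendsto_diff poly_over_power_tendsto assms tendsto_const that True)
    hence "(\<lambda>k. norm (poly (C z) (of_nat k) / of_nat k ^ m - coeff (C z) m)) \<longlonglongrightarrow> 0"
      by (simp add: tendsto_norm_zero)
    moreover have "norm (poly (C z) (of_nat k) / of_nat k ^ m - coeff (C z) m) = norm (t z k)" for k
    proof -
      have "t z k = (poly (C z) (of_nat k) / of_nat k ^ m - coeff (C z) m) * (z ^ k / of_real r ^ k)"
        using True by (simp add: t_def algebra_simps)
      thus ?thesis using True \<open>r > 0\<close> by (simp only: norm_mult) (simp add: norm_divide norm_power)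
    qed
    ultimately show ?thesis by (simp add: tendsto_norm_zero_iff)
  next
    case False
    \<comment> \<open>Inside the circle the degree may exceed \<open>m\<close>. A spare factor k^d
      is therefore moved from the polynomial quotient to the decaying power.\<close>
    define d where "d = degree (C z)"
    have "norm (z / of_real r) < 1"
      using False assms(3)[OF that] \<open>r > 0\<close> by (simp add: norm_divide)
    hence "(\<lambda>k. poly (C z) (of_nat k) / of_nat k ^ (m + d) * (of_nat k ^ d * (z / of_real r) ^ k))
        \<longlonglongrightarrow> coeff (C z) (m + d) * 0"
      by (intro tendsto_mult poly_over_power_tendsto of_nat_power_times_power_tendsto_0)
         (auto simp: d_def)
    hence lim: "(\<lambda>k. poly (C z) (of_nat k) / of_nat k ^ (m + d) * (of_nat k ^ d * (z / of_real r) ^ k))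
        \<longlonglongrightarrow> 0" by simp
    show ?thesis
    proof (rule Lim_transform_eventually[OF lim])
      show "\<forall>\<^sub>F k in sequentially.
          poly (C z) (of_nat k) / of_nat k ^ (m + d) * (of_nat k ^ d * (z / of_real r) ^ k) = t z k"
        using eventually_gt_at_top[of 0]
        by eventually_elim (use False \<open>r > 0\<close> in \<open>simp add: t_def power_add power_divide\<close>)
    qed
  qed
  hence "(\<lambda>k. \<Sum>z | C z \<noteq> 0. t z k) \<longlonglongrightarrow> 0"
    by (intro tendsto_null_sum) auto
  moreover have "(\<Sum>z | C z \<noteq> 0. t z k) = exp_poly C (int k) / (of_nat k ^ m * of_real r ^ k)
            - (\<Sum>z | C z \<noteq> 0 \<and> cmod z = r. coeff (C z) m * z ^ k) / of_real r ^ k" for k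
  proof -
    have "(\<Sum>z | C z \<noteq> 0 \<and> cmod z = r. coeff (C z) m * z ^ k / of_real r ^ k)
        = (\<Sum>z | C z \<noteq> 0. if cmod z = r then coeff (C z) m * z ^ k / of_real r ^ k else 0)"
      using sum.inter_restrict[OF assms(1), of _ "{z. cmod z = r}"]
      by (simp add: Int_def)
    thus ?thesis
      by (simp add: t_def exp_poly_def sum_subtractf sum_divide_distrib)
  qed
  ultimately show ?thesis by simp
qed

section \<open>Dominating terms and uniqueness of the representation\<close>

definition dominates :: "(complex \<Rightarrow> complex poly) \<Rightarrow> complex \<Rightarrow> bool" where
  "dominates C z \<longleftrightarrow> C z \<noteq> 0 \<and> (\<forall>w. C w \<noteq> 0 \<longrightarrow>
     cmod w \<le> cmod z \<and> (cmod w = cmod z \<longrightarrow> degree (C w) \<le> degree (C z)))"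

text \<open>Dominating means maximal for the lexicographic order on pairs of modulus and degree.
  Existence follows by maximising the modulus first and then the degree; several terms may attain
  the maximum.\<close>

lemma ex_dominates:
  assumes "finite {z. C z \<noteq> 0}" "C y \<noteq> 0"
  shows "\<exists>z. dominates C z"
proof -
  define r where "r = Max (cmod ` {z. C z \<noteq> 0})"
  define T where "T = {z. C z \<noteq> 0 \<and> cmod z = r}"
  have "r \<in> cmod ` {z. C z \<noteq> 0}" unfolding r_def using assms by (intro Max_in) auto
  hence "T \<noteq> {}" by (auto simp: T_def)
  have "finite T" using assms(1) by (rule rev_finite_subset) (auto simp: T_def)
  have r: "cmod w \<le> r" if "C w \<noteq> 0" for w
    unfolding r_def using assms(1) that by (intro Max_ge) auto
  have "Max ((\<lambda>z. degree (C z)) ` T) \<in> (\<lambda>z. degree (C z)) ` T"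
    using \<open>finite T\<close> \<open>T \<noteq> {}\<close> by (intro Max_in) auto
  then obtain z where z: "z \<in> T" "degree (C z) = Max ((\<lambda>z. degree (C z)) ` T)" by auto
  have "degree (C w) \<le> degree (C z)" if "w \<in> T" for w
    unfolding z(2) using \<open>finite T\<close> that by (intro Max_ge) auto
  with z(1) r have "dominates C z" by (auto simp: dominates_def T_def)
  thus ?thesis by blast
qed

lemma dominates_asymptotics:
  assumes "finite {z. C z \<noteq> 0}" "C 0 = 0" "dominates C z"
  shows "(\<lambda>k. exp_poly C (int k) / (of_nat k ^ degree (C z) * of_real (cmod z) ^ k)
            - (\<Sum>w | C w \<noteq> 0 \<and> cmod w = cmod z. coeff (C w) (degree (C z)) * w ^ k)
                / of_real (cmod z) ^ k) \<longlonglongrightarrow> 0"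
  using assms by (intro exp_poly_asymptotics) (auto simp: dominates_def)

text \<open>Otherwise some term dominates, the normalised power sum is null, and isolating that term
  would make its leading coefficient 0.\<close>

lemma exp_poly_eq_0_imp_coeffs_0:
  assumes "finite {z. C z \<noteq> 0}" "C 0 = 0" "\<And>k. k \<ge> k0 \<Longrightarrow> exp_poly C k = 0"
  shows "C y = 0"
proof (rule ccontr)
  assume "C y \<noteq> 0"
  then obtain z where z: "dominates C z" using ex_dominates[OF assms(1)] by blast
  define T where "T = {w. C w \<noteq> 0 \<and> cmod w = cmod z}"
  define m where "m = degree (C z)"
  have "z \<in> T" "z \<noteq> 0" using z assms(2) by (auto simp: T_def dominates_def)
  have "finite T" using assms(1) by (rule rev_finite_subset) (auto simp: T_def)
  have "(\<lambda>k. - ((\<Sum>w\<in>T. coeff (C w) m * w ^ k) / of_real (cmod z) ^ k)) \<longlonglongrightarrow> 0"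
  proof (rule Lim_transform_eventually[OF dominates_asymptotics[OF assms(1,2) z]])
    show "\<forall>\<^sub>F k in sequentially. exp_poly C (int k) / (of_nat k ^ degree (C z) * of_real (cmod z) ^ k)
            - (\<Sum>w | C w \<noteq> 0 \<and> cmod w = cmod z. coeff (C w) (degree (C z)) * w ^ k)
                / of_real (cmod z) ^ k = - ((\<Sum>w\<in>T. coeff (C w) m * w ^ k) / of_real (cmod z) ^ k)"
      using eventually_ge_at_top[of "nat k0"]
      by eventually_elim (simp add: T_def m_def assms(3))
  qed
  hence "(\<lambda>k. (\<Sum>w\<in>T. coeff (C w) m * w ^ k) / of_real (cmod z) ^ k) \<longlonglongrightarrow> 0"
    by (simp flip: tendsto_minus_cancel_left)
  hence "coeff (C z) m = 0"
    using \<open>finite T\<close> \<open>z \<in> T\<close> \<open>z \<noteq> 0\<close>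
    by (intro power_sum_tendsto_0_imp_coeff_0[where T = T and r = "cmod z"]) (auto simp: T_def)
  thus False using z by (simp add: m_def dominates_def)
qed

section \<open>Ratio limits of exponential polynomials\<close>

lemma eventually_at_top_int_iff:
  "(\<forall>\<^sub>F k in at_top. P (k::int)) \<longleftrightarrow> (\<forall>\<^sub>F k in sequentially. P (int k))"
proof
  assume "\<forall>\<^sub>F k in at_top. P (k::int)"
  thus "\<forall>\<^sub>F k in sequentially. P (int k)"
    using filterlim_int_sequentially by (auto simp: filterlim_iff)
next
  assume "\<forall>\<^sub>F k in sequentially. P (int k)"
  then obtain N where "\<And>k. k \<ge> N \<Longrightarrow> P (int k)" by (auto simp: eventually_sequentially)
  hence "P k" if "k \<ge> int N" for k
    using that by (metis nat_0_le nat_le_iff le_nat_iff of_nat_0_le_iff order_trans)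
  thus "\<forall>\<^sub>F k in at_top. P (k::int)" by (auto simp: eventually_at_top_linorder)
qed

lemma has_ratio_limit_iff_sequentially:
  "has_ratio_limit F L \<longleftrightarrow> (\<forall>\<^sub>F k in sequentially. F (int k) \<noteq> 0) \<and>
     (\<lambda>k. F (int (Suc k)) / F (int k)) \<longlonglongrightarrow> L"
proof -
  have "(\<exists>k0. \<forall>k>k0. F k \<noteq> 0) \<longleftrightarrow> (\<forall>\<^sub>F k in at_top. F k \<noteq> 0)"
    by (simp add: eventually_at_top_dense)
  moreover have "((\<lambda>k. F (k + 1) / F k) \<longlongrightarrow> L) at_top \<longleftrightarrow> (\<lambda>k. F (int (Suc k)) / F (int k)) \<longlonglongrightarrow> L"
    unfolding tendsto_def eventually_at_top_int_iff by (simp add: add.commute)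
  ultimately show ?thesis unfolding has_ratio_limit_def eventually_at_top_int_iff by blast
qed

lemma has_ratio_limit_cong:
  assumes "\<And>k. k \<ge> k0 \<Longrightarrow> F k = G k"
  shows "has_ratio_limit F L \<longleftrightarrow> has_ratio_limit G L"
proof -
  have ev: "\<forall>\<^sub>F k in sequentially. F (int k) = G (int k) \<and> F (int (Suc k)) = G (int (Suc k))"
    using eventually_ge_at_top[of "nat k0"] by eventually_elim (auto intro!: assms)
  have "(\<forall>\<^sub>F k in sequentially. F (int k) \<noteq> 0) \<longleftrightarrow> (\<forall>\<^sub>F k in sequentially. G (int k) \<noteq> 0)"
    by (rule eventually_cong[OF ev]) auto
  moreover have "(\<lambda>k. F (int (Suc k)) / F (int k)) \<longlonglongrightarrow> L \<longleftrightarrow> (\<lambda>k. G (int (Suc k)) / G (int k)) \<longlonglongrightarrow> L"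
    by (rule tendsto_cong) (use ev in eventually_elim, auto)
  ultimately show ?thesis unfolding has_ratio_limit_iff_sequentially by blast
qed

lemma Suc_over_power_tendsto_1: "(\<lambda>k. (of_nat (Suc k) / of_nat k :: complex) ^ m) \<longlonglongrightarrow> 1"
  using tendsto_power[OF LIMSEQ_Suc_n_over_n, of m] by simp

text \<open>Every other term of the same modulus has smaller degree, so its coefficient at
  \<open>m\<close> is 0. Hence the values behave like l * k^m * z^k, and the quotient of consecutive
  ones tends to z.\<close>

lemma unique_dominates_imp_ratio_limit:
  assumes "finite {z. C z \<noteq> 0}" "C 0 = 0" "dominates C z" "\<And>w. dominates C w \<Longrightarrow> w = z"
  shows "has_ratio_limit (exp_poly C) z"
proof -
  define T where "T = {w. C w \<noteq> 0 \<and> cmod w = cmod z}"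
  define m where "m = degree (C z)"
  define l where "l = lead_coeff (C z)"
  have "z \<in> T" "z \<noteq> 0" "l \<noteq> 0" using assms(2,3) by (auto simp: T_def l_def dominates_def)
  have "finite T" using assms(1) by (rule rev_finite_subset) (auto simp: T_def)
  have "coeff (C w) m = 0" if "w \<in> T" "w \<noteq> z" for w
  proof -
    have "\<not> dominates C w" using assms(4) that by blast
    with that(1) assms(3) have "degree (C w) < m"
      unfolding dominates_def T_def m_def by (smt (verit) le_eq_less_or_eq mem_Collect_eq order_trans)
    thus ?thesis by (rule coeff_eq_0)
  qed
  hence sum: "(\<Sum>w\<in>T. coeff (C w) m * w ^ k) = l * z ^ k" for k
    using \<open>finite T\<close> \<open>z \<in> T\<close> by (simp add: sum.remove l_def m_def)
  \<comment> \<open>Normalising by z^k instead of its modulus only removes a factor of modulus 1,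
    which leaves the norm of the error unchanged.\<close>
  define q where "q k = exp_poly C (int k) / (of_nat k ^ m * z ^ k)" for k
  have "(\<lambda>k. exp_poly C (int k) / (of_nat k ^ m * of_real (cmod z) ^ k)
            - l * z ^ k / of_real (cmod z) ^ k) \<longlonglongrightarrow> 0"
    using dominates_asymptotics[OF assms(1-3)] unfolding m_def[symmetric] T_def[symmetric] sum .
  hence "(\<lambda>k. norm (exp_poly C (int k) / (of_nat k ^ m * of_real (cmod z) ^ k)
            - l * z ^ k / of_real (cmod z) ^ k)) \<longlonglongrightarrow> 0" by (rule tendsto_norm_zero)
  moreover have "norm (exp_poly C (int k) / (of_nat k ^ m * of_real (cmod z) ^ k)
            - l * z ^ k / of_real (cmod z) ^ k) = norm (q k - l)" for k
  proof -
    have "exp_poly C (int k) / (of_nat k ^ m * of_real (cmod z) ^ k)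
            - l * z ^ k / of_real (cmod z) ^ k = (q k - l) * (z ^ k / of_real (cmod z) ^ k)"
      using \<open>z \<noteq> 0\<close> by (simp add: q_def algebra_simps)
    thus ?thesis using \<open>z \<noteq> 0\<close> by (simp only: norm_mult) (simp add: norm_divide norm_power)
  qed
  ultimately have q: "q \<longlonglongrightarrow> l"
    using LIM_zero_iff[of q l sequentially] by (simp add: tendsto_norm_zero_iff)
  hence "\<forall>\<^sub>F k in sequentially. q k \<noteq> 0" using \<open>l \<noteq> 0\<close> by (rule tendsto_imp_eventually_ne)
  hence ev: "\<forall>\<^sub>F k in sequentially. exp_poly C (int k) \<noteq> 0"
    by eventually_elim (auto simp: q_def)
  have "(\<lambda>k. q (Suc k) / q k * (of_nat (Suc k) / of_nat k) ^ m * z) \<longlonglongrightarrow> l / l * 1 * z"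
    by (intro tendsto_mult tendsto_divide LIMSEQ_Suc[OF q] q Suc_over_power_tendsto_1 tendsto_const \<open>l \<noteq> 0\<close>)
  hence lim: "(\<lambda>k. q (Suc k) / q k * (of_nat (Suc k) / of_nat k) ^ m * z) \<longlonglongrightarrow> z"
    using \<open>l \<noteq> 0\<close> by simp
  have "(\<lambda>k. exp_poly C (int (Suc k)) / exp_poly C (int k)) \<longlonglongrightarrow> z"
  proof (rule Lim_transform_eventually[OF lim])
    show "\<forall>\<^sub>F k in sequentially. q (Suc k) / q k * (of_nat (Suc k) / of_nat k) ^ m * z =
        exp_poly C (int (Suc k)) / exp_poly C (int k)"
      using ev eventually_gt_at_top[of 0]
    proof eventually_elim
      case (elim k)
      moreover have "of_nat (Suc k) \<noteq> (0::complex)" by (rule of_nat_neq_0)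
      ultimately show ?case using \<open>z \<noteq> 0\<close>
        by (simp add: q_def power_divide field_simps del: of_nat_Suc)
    qed
  qed
  with ev show ?thesis by (simp add: has_ratio_limit_iff_sequentially)
qed

text \<open>Because every dominating z must equal the same L, this also shows that at most one term
  dominates.\<close>

lemma ratio_limit_eq_dominating:
  assumes "finite {z. C z \<noteq> 0}" "C 0 = 0" "has_ratio_limit (exp_poly C) L" "dominates C z"
  shows "z = L"
proof -
  define T where "T = {w. C w \<noteq> 0 \<and> cmod w = cmod z}"
  define m where "m = degree (C z)"
  define r where "r = complex_of_real (cmod z)"
  have "z \<in> T" "z \<noteq> 0" using assms(2,4) by (auto simp: T_def dominates_def)
  hence "r \<noteq> 0" by (simp add: r_def)
  have "finite T" using assms(1) by (rule rev_finite_subset) (auto simp: T_def)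
  define u where "u k = (\<Sum>w\<in>T. coeff (C w) m * w ^ k) / r ^ k" for k
  define v where "v k = exp_poly C (int k) / (of_nat k ^ m * r ^ k)" for k
  have vu: "(\<lambda>k. v k - u k) \<longlonglongrightarrow> 0"
    using dominates_asymptotics[OF assms(1,2,4)] by (simp add: u_def v_def T_def m_def r_def)
  have "norm (u k) \<le> (\<Sum>w\<in>T. norm (coeff (C w) m))" for k
  proof -
    have "norm (u k) \<le> (\<Sum>w\<in>T. norm (coeff (C w) m * w ^ k / r ^ k))"
      unfolding u_def sum_divide_distrib by (rule norm_sum)
    also have "\<dots> = (\<Sum>w\<in>T. norm (coeff (C w) m))"
      by (rule sum.cong) (use \<open>z \<noteq> 0\<close> in \<open>auto simp: T_def r_def norm_mult norm_divide norm_power\<close>)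
    finally show ?thesis .
  qed
  \<comment> \<open>Boundedness of \<open>u\<close> keeps its products with null sequences null; the
    reindexing \<open>g\<close> serves both \<open>u k\<close> and \<open>u (Suc k)\<close>.\<close>
  hence u_null: "(\<lambda>k. u (g k) * e k) \<longlonglongrightarrow> 0" if "e \<longlonglongrightarrow> 0" for g e
  proof -
    have "Bfun (\<lambda>k. u (g k)) sequentially"
      using \<open>\<And>k. norm (u k) \<le> _\<close> by (intro BfunI always_eventually allI)
    from bounded_bilinear.Bfun_prod_Zfun[OF bounded_bilinear_mult this] that
    show ?thesis by (simp add: tendsto_Zfun_iff)
  qed
  note ev = assms(3)[unfolded has_ratio_limit_iff_sequentially, THEN conjunct1]
  note rat = assms(3)[unfolded has_ratio_limit_iff_sequentially, THEN conjunct2]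
  define \<rho> where "\<rho> k = exp_poly C (int (Suc k)) / exp_poly C (int k)" for k
  have "(\<lambda>k. \<rho> k - L) \<longlonglongrightarrow> 0" using rat unfolding \<rho>_def by (rule LIM_zero)
  hence "(\<lambda>k. (v k - u k) * (\<rho> k - L) + u k * (\<rho> k - L)) \<longlonglongrightarrow> 0"
    using u_null[of "\<lambda>k. \<rho> k - L" "\<lambda>k. k"] tendsto_mult_zero[OF vu] by (intro tendsto_add_zero)
  hence lim: "(\<lambda>k. v k * (\<rho> k - L)) \<longlonglongrightarrow> 0" by (simp add: algebra_simps)
  \<comment> \<open>The normalisations of \<open>v\<close> at k and k + 1 differ by the factor
    \<open>s k * r\<close>.\<close>
  define s where "s k = (of_nat (Suc k) / of_nat k :: complex) ^ m" for k
  have s: "s \<longlonglongrightarrow> 1" unfolding s_def by (rule Suc_over_power_tendsto_1)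
  have x: "(\<lambda>k. s k * r * v (Suc k) - L * v k) \<longlonglongrightarrow> 0"
  proof (rule Lim_transform_eventually[OF lim])
    show "\<forall>\<^sub>F k in sequentially. v k * (\<rho> k - L) = s k * r * v (Suc k) - L * v k"
      using ev eventually_gt_at_top[of 0]
    proof eventually_elim
      case (elim k)
      have "of_nat (Suc k) \<noteq> (0::complex)" by (rule of_nat_neq_0)
      with elim \<open>r \<noteq> 0\<close> have "v k * \<rho> k = s k * r * v (Suc k)"
        by (simp add: v_def s_def \<rho>_def power_divide del: of_nat_Suc)
      thus ?case by (simp add: algebra_simps)
    qed
  qed
  \<comment> \<open>The three correction terms replace \<open>v\<close> by \<open>u\<close> and
    \<open>s k\<close> by 1; what remains is \<open>r * u (Suc k) - L * u k\<close>.\<close>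
  have "(\<lambda>k. s k * r * v (Suc k) - L * v k - s k * r * (v (Suc k) - u (Suc k))
          - r * (u (Suc k) * (s k - 1)) + L * (v k - u k)) \<longlonglongrightarrow> 0 - 1 * r * 0 - r * 0 + L * 0"
    by (intro tendsto_add tendsto_diff tendsto_mult x s vu LIMSEQ_Suc[OF vu] tendsto_const u_null LIM_zero)
  moreover have "s k * r * v (Suc k) - L * v k - s k * r * (v (Suc k) - u (Suc k))
          - r * (u (Suc k) * (s k - 1)) + L * (v k - u k)
      = (\<Sum>w\<in>T. (coeff (C w) m * (w - L)) * w ^ k) / r ^ k" for k
  proof -
    have "(\<Sum>w\<in>T. (coeff (C w) m * (w - L)) * w ^ k)
        = (\<Sum>w\<in>T. coeff (C w) m * w ^ Suc k) - L * (\<Sum>w\<in>T. coeff (C w) m * w ^ k)"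
      by (simp add: sum_distrib_left algebra_simps flip: sum_subtractf)
    also have "\<dots> / r ^ k = r * u (Suc k) - L * u k"
      using \<open>r \<noteq> 0\<close> by (simp add: u_def diff_divide_distrib)
    finally show ?thesis by (simp add: algebra_simps)
  qed
  ultimately have "(\<lambda>k. (\<Sum>w\<in>T. (coeff (C w) m * (w - L)) * w ^ k) / r ^ k) \<longlonglongrightarrow> 0" by simp
  hence "coeff (C z) m * (z - L) = 0"
    unfolding r_def using \<open>finite T\<close> \<open>z \<in> T\<close> \<open>z \<noteq> 0\<close>
    by (intro power_sum_tendsto_0_imp_coeff_0[where T = T and r = "cmod z"]) (auto simp: T_def)
  thus ?thesis using assms(4) by (simp add: m_def dominates_def)
qed

section \<open>The recurrence and the characteristic polynomial of a solution\<close>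

lemma poly_eq_sum_lessThan:
  fixes p :: "complex poly"
  assumes "\<forall>i\<ge>N. coeff p i = 0"
  shows "poly p x = (\<Sum>j<N. coeff p j * x ^ j)"
proof -
  have "p = (\<Sum>j<N. monom (coeff p j) j)"
    using assms by (auto simp: poly_eq_iff coeff_sum if_distrib not_less)
  hence "poly p x = poly (\<Sum>j<N. monom (coeff p j) j) x" by simp
  thus ?thesis by (simp add: poly_sum poly_monom)
qed

lemma coeff_char_poly_rec:
  "coeff (char_poly_rec n b) i = (if i = n then 1 else 0) - (\<Sum>j=1..n. if n - j = i then b j else 0)"
  by (auto simp: char_poly_rec_def coeff_sum)

lemma poly_char_poly_rec_0:
  assumes "n \<ge> 1"
  shows "poly (char_poly_rec n b) 0 = - b n"
proof -
  have "(\<Sum>j=1..n. if n - j = 0 then b j else 0) = (\<Sum>j=1..n. if j = n then b j else 0)"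
    by (rule sum.cong) auto
  thus ?thesis using assms by (simp add: poly_0_coeff_0 coeff_char_poly_rec)
qed

lemma shift_op_char_poly_rec:
  "shift_op (char_poly_rec n b) f k = f (k + int n) - (\<Sum>j=1..n. b j * f (k + int n - int j))"
proof -
  have deg: "degree (char_poly_rec n b) \<le> n"
    by (rule degree_le) (auto simp: coeff_char_poly_rec intro!: sum.neutral)
  have "(\<Sum>i\<le>n. (\<Sum>j=1..n. if n - j = i then b j else 0) * f (k + int i))
      = (\<Sum>j=1..n. \<Sum>i\<le>n. if n - j = i then b j * f (k + int i) else 0)"
    unfolding sum_distrib_right by (subst sum.swap) (intro sum.cong refl, simp)
  also have "\<dots> = (\<Sum>j=1..n. b j * f (k + int n - int j))"
    by (rule sum.cong) (auto simp: of_nat_diff algebra_simps)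
  finally have "(\<Sum>i\<le>n. (\<Sum>j=1..n. if n - j = i then b j else 0) * f (k + int i))
      = (\<Sum>j=1..n. b j * f (k + int n - int j))" .
  moreover have "(\<Sum>i\<le>n. (if i = n then 1 else 0) * f (k + int i)) = f (k + int n)"
    by (simp add: if_distrib if_distribR cong: if_cong)
  ultimately show ?thesis
    unfolding shift_op_eq_sum[OF deg] coeff_char_poly_rec left_diff_distrib sum_subtractf by simp
qed

text \<open>This ties the coefficients given by a definite description to a family of polynomials.
  Existence comes from the kernel of the shift polynomial, uniqueness from the vanishing lemma
  applied to a difference.\<close>

lemma exp_poly_representation:
  assumes "n \<ge> 1" "b n \<noteq> 0"
  obtains C where "finite {z. C z \<noteq> 0}" "C 0 = 0"
    "\<And>k. k \<ge> 1 - int n \<Longrightarrow> rec_solution n b a k = exp_poly C k"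
    "solution_coeff n b a = (\<lambda>z. coeff (C z))"
proof -
  define P where "P = char_poly_rec n b"
  define R where "R = {z. poly P z = 0}"
  have "poly P 0 \<noteq> 0" using assms by (simp add: P_def poly_char_poly_rec_0)
  hence "P \<noteq> 0" by auto
  hence "finite R" unfolding R_def by (rule poly_roots_finite)
  have order0: "order z P = 0" if "z \<notin> R" for z using that by (simp add: R_def order_0I)
  have admissible: "{z. C z \<noteq> 0} \<subseteq> R \<and> finite {z. C z \<noteq> 0} \<and> C 0 = 0"
    if "\<forall>z. \<forall>i\<ge>order z P. coeff (C z) i = 0" for C :: "complex \<Rightarrow> complex poly"
  proof -
    have "C z = 0" if "z \<notin> R" for z
      using \<open>\<forall>z. _ z\<close> order0[OF that] by (auto simp: poly_eq_iff)
    hence "{z. C z \<noteq> 0} \<subseteq> R" by blast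
    moreover from this have "finite {z. C z \<noteq> 0}" using \<open>finite R\<close> by (rule finite_subset)
    ultimately show ?thesis using \<open>poly P 0 \<noteq> 0\<close> by (auto simp: R_def)
  qed
  have represents: "represents_solution n b a (\<lambda>z. coeff (C z)) \<longleftrightarrow>
      (\<forall>k\<ge>1 - int n. rec_solution n b a k = exp_poly C k)"
    if C: "\<forall>z. \<forall>i\<ge>order z P. coeff (C z) i = 0" for C
  proof -
    have "exp_poly C k = (\<Sum>z\<in>R. \<Sum>j<order z P. coeff (C z) j * of_int k ^ j * z powi k)" for k
    proof -
      have "exp_poly C k = (\<Sum>z\<in>R. poly (C z) (of_int k) * z powi k)"
        by (rule exp_poly_eq_sum[OF \<open>finite R\<close>]) (use admissible[OF C] in blast)
      moreover have "poly (C z) x = (\<Sum>j<order z P. coeff (C z) j * x ^ j)" for z x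
        using C by (intro poly_eq_sum_lessThan) blast
      ultimately show ?thesis by (simp add: sum_distrib_right)
    qed
    thus ?thesis using C order0
      unfolding represents_solution_def P_def[symmetric] R_def by (auto simp: not_less)
  qed
  \<comment> \<open>The shift equation at k is the recurrence at k + n, which is at least 1, so the
    recursive branch applies.\<close>
  have "shift_op P (rec_solution n b a) k = 0" if "k \<ge> 1 - int n" for k
    unfolding P_def shift_op_char_poly_rec
    by (subst rec_solution.simps) (use that in auto)
  from shift_op_0_imp_exp_poly[OF \<open>poly P 0 \<noteq> 0\<close> this] obtain C where
    C: "\<forall>z. \<forall>i\<ge>order z P. coeff (C z) i = 0"
       "\<forall>k\<ge>1 - int n. rec_solution n b a k = exp_poly C k" by blast
  have "solution_coeff n b a = (\<lambda>z. coeff (C z))"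
    unfolding solution_coeff_def
  proof (rule the_equality)
    show "represents_solution n b a (\<lambda>z. coeff (C z))" using represents[OF C(1)] C(2) by blast
  next
    fix c assume c: "represents_solution n b a c"
    \<comment> \<open>A competing coefficient family vanishes from the order on, so it too consists
      of coefficients of polynomials.\<close>
    define D where "D z = (\<Sum>j<order z P. monom (c z j) j)" for z
    have "c z j = 0" if "j \<ge> order z P" for z j
      using c that unfolding represents_solution_def P_def by auto
    hence coeff_D: "coeff (D z) j = c z j" for z j
      by (simp add: D_def coeff_sum not_less)
    hence c_eq: "c = (\<lambda>z. coeff (D z))" by (intro ext) simp
    have D: "\<forall>z. \<forall>i\<ge>order z P. coeff (D z) i = 0"
      using \<open>\<And>z j. _ \<Longrightarrow> c z j = 0\<close> by (simp add: coeff_D)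
    have D_eq: "rec_solution n b a k = exp_poly D k" if "k \<ge> 1 - int n" for k
      using c that unfolding c_eq represents[OF D] by blast
    define E where "E z = C z - D z" for z
    have E: "\<forall>z. \<forall>i\<ge>order z P. coeff (E z) i = 0" using C(1) D by (simp add: E_def)
    have "exp_poly E k = exp_poly C k - exp_poly D k" for k
      using admissible[OF C(1)] admissible[OF D] admissible[OF E]
      by (simp add: exp_poly_eq_sum[OF \<open>finite R\<close>] E_def left_diff_distrib sum_subtractf)
    hence "exp_poly E k = 0" if "k \<ge> 1 - int n" for k
      using C(2) D_eq that by simp
    with admissible[OF E] have "E z = 0" for z
      using exp_poly_eq_0_imp_coeffs_0[of E "1 - int n" z] by blast
    thus "c = (\<lambda>z. coeff (C z))" unfolding c_eq by (simp add: E_def)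
  qed
  show thesis
  proof (rule that)
    show "finite {z. C z \<noteq> 0}" "C 0 = 0" using admissible[OF C(1)] by auto
  qed (use C(2) \<open>solution_coeff n b a = _\<close> in auto)
qed

lemma char_poly_solution_eq:
  assumes "solution_coeff n b a = (\<lambda>z. coeff (C z))"
  shows "char_poly_solution n b a = (\<Prod>z | C z \<noteq> 0. [:-z, 1:] ^ (degree (C z) + 1))"
proof -
  have S: "{z. \<exists>j. coeff (C z) j \<noteq> 0} = {z. C z \<noteq> 0}" by (auto simp: poly_eq_iff)
  have "Max {j. coeff (C z) j \<noteq> 0} = degree (C z)" if "C z \<noteq> 0" for z
  proof (rule Max_eqI)
    show "finite {j. coeff (C z) j \<noteq> 0}"
      by (rule finite_subset[of _ "{..degree (C z)}"]) (auto intro: le_degree)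
  qed (use that in \<open>auto intro: le_degree\<close>)
  thus ?thesis unfolding char_poly_solution_def assms S by (intro prod.cong) auto
qed

text \<open>The zeros of the product form the support of \<open>C\<close>, and each order is the
  degree plus one; this uniform offset does not affect comparisons.\<close>

lemma is_dominant_zero_prod_iff:
  assumes "finite {z. C z \<noteq> 0}"
  shows "is_dominant_zero (\<Prod>z | C z \<noteq> 0. [:-z, 1:] ^ (degree (C z) + 1)) w \<longleftrightarrow> dominates C w"
proof -
  define Q where "Q = (\<Prod>z | C z \<noteq> 0. [:-z, 1:] ^ (degree (C z) + 1))"
  have root: "poly Q z = 0 \<longleftrightarrow> C z \<noteq> 0" for z
    using assms by (auto simp: Q_def poly_prod)
  have order: "order z Q = degree (C z) + 1" if "C z \<noteq> 0" for z
  proof -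
    define Q' where "Q' = (\<Prod>y\<in>{y. C y \<noteq> 0} - {z}. [:-y, 1:] ^ (degree (C y) + 1))"
    have Q: "Q = [:-z, 1:] ^ (degree (C z) + 1) * Q'"
      unfolding Q_def Q'_def using assms that by (intro prod.remove) auto
    have Q': "poly Q' z \<noteq> 0" using assms by (auto simp: Q'_def poly_prod)
    have "[:-z, 1:] ^ (degree (C z) + 1) * Q' \<noteq> 0"
      using Q' by (intro power_not_zero no_zero_divisors) auto
    hence "order z Q = order z ([:-z, 1:] ^ (degree (C z) + 1)) + order z Q'"
      unfolding Q by (rule order_mult)
    thus ?thesis unfolding order_power_n_n order_0I[OF Q'] by simp
  qed
  show ?thesis
    unfolding Q_def[symmetric] is_dominant_zero_def max_modulus_zeros_def root dominates_def
    using order by (auto intro: order_antisym) (metis order_antisym le_refl order_trans)+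
qed

theorem theorem2:
  fixes n :: nat and b :: "nat \<Rightarrow> complex" and a :: "int \<Rightarrow> complex"
  assumes "n \<ge> 1" and "b n \<noteq> 0"
  shows "((\<exists>L. has_ratio_limit (rec_solution n b a) L) \<longleftrightarrow>
            asymptotically_simple (char_poly_solution n b a)) \<and>
         (asymptotically_simple (char_poly_solution n b a) \<longrightarrow>
            has_ratio_limit (rec_solution n b a) (dominant_zero (char_poly_solution n b a)))"
proof -
  obtain C where C: "finite {z. C z \<noteq> 0}" "C 0 = 0"
    "\<And>k. k \<ge> 1 - int n \<Longrightarrow> rec_solution n b a k = exp_poly C k"
    "solution_coeff n b a = (\<lambda>z. coeff (C z))"
    using exp_poly_representation[where n = n and b = b and a = a] assms by blast
  define P where "P = char_poly_solution n b a"
  have dom: "is_dominant_zero P z \<longleftrightarrow> dominates C z" for z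
    unfolding P_def char_poly_solution_eq[OF C(4)] by (rule is_dominant_zero_prod_iff[OF C(1)])
  have lim_iff: "has_ratio_limit (rec_solution n b a) L \<longleftrightarrow> has_ratio_limit (exp_poly C) L" for L
    by (rule has_ratio_limit_cong) (rule C(3))
  have "has_ratio_limit (exp_poly C) (dominant_zero P)" if "asymptotically_simple P"
  proof -
    from that have "is_dominant_zero P (dominant_zero P)"
      and "\<And>w. is_dominant_zero P w \<Longrightarrow> w = dominant_zero P"
      unfolding asymptotically_simple_def dominant_zero_def
      by (auto intro: theI' the1_equality[symmetric])
    thus ?thesis unfolding dom by (intro unique_dominates_imp_ratio_limit C(1,2))
  qed
  moreover have "asymptotically_simple P" if L: "has_ratio_limit (exp_poly C) L" for L
  proof -
    \<comment> \<open>The zero solution has no ratio limit, as its values are never nonzero. This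
      secures the existence half of asymptotic simplicity.\<close>
    have "\<exists>y. C y \<noteq> 0"
    proof (rule ccontr)
      assume "\<not> ?thesis"
      hence "exp_poly C k = 0" for k by (simp add: exp_poly_def)
      thus False using L by (auto simp: has_ratio_limit_def dest: spec[of _ "_ + 1"])
    qed
    then obtain z where "dominates C z" using ex_dominates[OF C(1)] by blast
    thus ?thesis unfolding asymptotically_simple_def dom
      using ratio_limit_eq_dominating[OF C(1,2) L] by metis
  qed
  ultimately show ?thesis unfolding lim_iff P_def by blast
qed

end
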